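(* Let $k\ge 1$ be an integer, let $G=(V,E,w)$ be a weighted graph, and let $C\subseteq E$ be a positive cut set whose deletion splits $G$ into exactly two connected components $G_1=(V_1,E_1,w_1)$ and $G_2=(V_2,E_2,w_2)$. Let $L=\partial_G(V_1)$ and $R=\partial_G(V_2)$, and let $V_C=L\sqcup R$ be the vertex set of $G[C]$. If the bipartite complement $\overline{G[C][L,R]}$ of $G[C]$ with respect to $L,R$ contains a matching $M$ of size $|M|\ge 2\cdot(|V_C|-k)-1$, then splitting $G$ into $G_1$ and $G_2$ by deleting $C$ is an optimality-preserving data separation for Max $k$-Cut, with reconstruction algorithm ReconstructSCS. That is, for every $k$-partition $p'$ of $V_1$ and every $k$-partition $p''$ of $V_2$, ReconstructSCS returns a $k$-partition $p$ of $V$ (and not an error), and if $p'$ and $p''$ are optimum Max $k$-Cut solutions for $G_1$ and $G_2$, respectively, then $p$ is an optimum Max $k$-Cut solution for $G$.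
   Context: A weighted graph is a finite simple undirected graph with real edge weights. A cut set is an edge set of the form $\delta_G(S)=\{\{s,t\}\in E: s\in S, t\notin S\}$ for some $S\subseteq V$; it is positive if all its edges have positive weight. Here $C=\delta_G(V_1)=\delta_G(V_2)$ and $V=V_1\sqcup V_2$. The boundary of $U\subseteq V$ is $\partial_G(U)=\{x\in U:\exists y\in V\setminus U,\ \{x,y\}\in E\}$. $G[C]$ is the graph with edge set $C$ whose vertices are exactly the endpoints of edges in $C$; it is bipartite with bipartition $L,R$. A $k$-partition of a set $M$ is a function $p:M\to\{1,\dots,k\}$. The weight of a $k$-partition of the vertices of a weighted graph is the sum of the weights of all edges whose endpoints have different colours; an optimum Max $k$-Cut solution is a $k$-partition of maximum weight. For a bipartite graph $B=(X\sqcup Y,F)$ with bipartition $X,Y$, the bipartite complement $\overline{B[X,Y]}$ with respect to $X,Y$ is the bipartite graph on $X\sqcup Y$ whose edges are all $\{x,y\}$ with $x\in X$, $y\in Y$, $\{x,y\}\notin F$. A data separation transforms a weighted graph $G$ into weighted graphs $G_1,\dots,G_i$ and provides a reconstruction algorithm that maps $k$-partitions of the vertex sets of $G_1,\dots,G_i$ to a $k$-partition of $V(G)$. It is optimality-preserving if the reconstruction maps any optimum solutions for $G_1,\dots,G_i$ to an optimum solution for $G$. Algorithm ReconstructSCS$(G,C,p',p'',k)$: (1) Determine the two components with vertex sets $V_1,V_2$ of $G$ without $C$. (2) Build the colour relation graph $G_{CR}$ with vertex set $\{1,\dots,k\}\times\{L,R\}$ (here $L,R$ are just labels for the two sides) and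 edge set $\{\{(p'(x),L),(p''(y),R)\} : \{x,y\}\in C,\ x\in V_1,\ y\in V_2\}$. (3) Compute a maximum matching $N$ in the bipartite complement of $G_{CR}$ with respect to $\{(i,L): 1\le i\le k\}$ and $\{(i,R): 1\le i\le k\}$. (4) If $|N|<k$, return the error "reconstruction not possible". (5) Otherwise set $\pi(j)=i$ for every $\{(i,L),(j,R)\}\in N$, and return the $k$-partition $p$ of $V$ with $p(v)=p'(v)$ for $v\in V_1$ and $p(v)=\pi(p''(v))$ for $v\in V_2$. *)

theory Defs
  imports Complex_Main "HOL-Library.FuncSet"
begin

record 'a graph =
  verts :: "'a set"
  edges :: "'a set set"

record 'a wgraph = "'a graph" +
  weight :: "'a set \<Rightarrow> real"

text \<open>Only the values of the weight function on the edges are meaningful; in particular, a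
  subgraph simply keeps the weight function of the ambient graph.\<close>

definition simple_graph :: "('a, 'b) graph_scheme \<Rightarrow> bool" where
  "simple_graph G \<longleftrightarrow> finite (verts G) \<and> (\<forall>e\<in>edges G. e \<subseteq> verts G \<and> card e = 2)"

definition weighted_graph :: "'a wgraph \<Rightarrow> bool" where
  "weighted_graph G \<longleftrightarrow> simple_graph G"

definition delete_edges :: "('a, 'b) graph_scheme \<Rightarrow> 'a set set \<Rightarrow> ('a, 'b) graph_scheme" where
  "delete_edges G C = G\<lparr>edges := edges G - C\<rparr>"

definition induced_subgraph :: "('a, 'b) graph_scheme \<Rightarrow> 'a set \<Rightarrow> ('a, 'b) graph_scheme" where
  "induced_subgraph G U = G\<lparr>verts := U, edges := {e \<in> edges G. e \<subseteq> U}\<rparr>"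

definition edge_graph :: "'a set set \<Rightarrow> 'a graph" where
  "edge_graph C = \<lparr>verts = \<Union>C, edges = C\<rparr>"

definition connected_rel :: "('a, 'b) graph_scheme \<Rightarrow> ('a \<times> 'a) set" where
  "connected_rel G =
     {(x, y). x \<in> verts G \<and> y \<in> verts G \<and> (x, y) \<in> {(a, b). {a, b} \<in> edges G}\<^sup>*}"

definition connected_components :: "('a, 'b) graph_scheme \<Rightarrow> ('a, 'b) graph_scheme set" where
  "connected_components G = induced_subgraph G ` (verts G // connected_rel G)"


definition cut :: "('a, 'b) graph_scheme \<Rightarrow> 'a set \<Rightarrow> 'a set set" where
  "cut G S = {e \<in> edges G. \<exists>s t. e = {s, t} \<and> s \<in> S \<and> t \<notin> S}"

definition cut_set :: "('a, 'b) graph_scheme \<Rightarrow> 'a set set \<Rightarrow> bool" where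
  "cut_set G C \<longleftrightarrow> (\<exists>S\<subseteq>verts G. C = cut G S)"

definition positive_cut_set :: "'a wgraph \<Rightarrow> 'a set set \<Rightarrow> bool" where
  "positive_cut_set G C \<longleftrightarrow> cut_set G C \<and> (\<forall>e\<in>C. weight G e > 0)"

definition boundary :: "('a, 'b) graph_scheme \<Rightarrow> 'a set \<Rightarrow> 'a set" where
  "boundary G U = {x \<in> U. \<exists>y\<in>verts G - U. {x, y} \<in> edges G}"

definition bipartite_complement ::
    "('a, 'b) graph_scheme \<Rightarrow> 'a set \<Rightarrow> 'a set \<Rightarrow> 'a graph" where
  "bipartite_complement B X Y =
     \<lparr>verts = X \<union> Y, edges = {{x, y} | x y. x \<in> X \<and> y \<in> Y \<and> {x, y} \<notin> edges B}\<rparr>"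

definition matching :: "('a, 'b) graph_scheme \<Rightarrow> 'a set set \<Rightarrow> bool" where
  "matching G M \<longleftrightarrow> M \<subseteq> edges G \<and> (\<forall>e\<in>M. \<forall>f\<in>M. e \<noteq> f \<longrightarrow> e \<inter> f = {})"

definition maximum_matching :: "('a, 'b) graph_scheme \<Rightarrow> 'a set set \<Rightarrow> bool" where
  "maximum_matching G M \<longleftrightarrow> is_arg_max card (matching G) M"


definition k_partition :: "nat \<Rightarrow> 'a set \<Rightarrow> ('a \<Rightarrow> nat) \<Rightarrow> bool" where
  "k_partition k A p \<longleftrightarrow> p \<in> A \<rightarrow>\<^sub>E {1..k}"

definition partition_weight :: "'a wgraph \<Rightarrow> ('a \<Rightarrow> nat) \<Rightarrow> real" where
  "partition_weight G p =
     (\<Sum>e \<in> {e \<in> edges G. \<exists>x y. e = {x, y} \<and> p x \<noteq> p y}. weight G e)"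

definition optimum_max_k_cut :: "nat \<Rightarrow> 'a wgraph \<Rightarrow> ('a \<Rightarrow> nat) \<Rightarrow> bool" where
  "optimum_max_k_cut k G p \<longleftrightarrow> is_arg_max (partition_weight G) (k_partition k (verts G)) p"


text \<open>A reconstruction algorithm may make arbitrary choices, so it is a relation between its
  input (one partition per graph) and its possible results, where \<open>None\<close> is an error. It must
  have a result on every input, and none of its possible results may be an error.\<close>

definition data_separation ::
    "nat \<Rightarrow> 'a wgraph \<Rightarrow> 'a wgraph list
      \<Rightarrow> (('a \<Rightarrow> nat) list \<Rightarrow> ('a \<Rightarrow> nat) option \<Rightarrow> bool) \<Rightarrow> bool" where
  "data_separation k G Gs rec \<longleftrightarrow>
     weighted_graph G \<and> (\<forall>H\<in>set Gs. weighted_graph H) \<and>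
     (\<forall>ps. list_all2 (\<lambda>H. k_partition k (verts H)) Gs ps \<longrightarrow>
        (\<exists>r. rec ps r) \<and>
        (\<forall>r. rec ps r \<longrightarrow> (\<exists>p. r = Some p \<and> k_partition k (verts G) p)))"

definition optimality_preserving_data_separation ::
    "nat \<Rightarrow> 'a wgraph \<Rightarrow> 'a wgraph list
      \<Rightarrow> (('a \<Rightarrow> nat) list \<Rightarrow> ('a \<Rightarrow> nat) option \<Rightarrow> bool) \<Rightarrow> bool" where
  "optimality_preserving_data_separation k G Gs rec \<longleftrightarrow>
     data_separation k G Gs rec \<and>
     (\<forall>ps p. list_all2 (optimum_max_k_cut k) Gs ps \<longrightarrow> rec ps (Some p) \<longrightarrow>
        optimum_max_k_cut k G p)"


datatype side = LeftSide | RightSide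

definition colour_relation_graph ::
    "'a set set \<Rightarrow> 'a set \<Rightarrow> 'a set \<Rightarrow> ('a \<Rightarrow> nat) \<Rightarrow> ('a \<Rightarrow> nat) \<Rightarrow> nat
      \<Rightarrow> (nat \<times> side) graph" where
  "colour_relation_graph C V1 V2 p' p'' k =
     \<lparr>verts = {1..k} \<times> {LeftSide, RightSide},
      edges = {{(p' x, LeftSide), (p'' y, RightSide)} | x y. {x, y} \<in> C \<and> x \<in> V1 \<and> y \<in> V2}\<rparr>"

definition colour_relation_complement ::
    "'a set set \<Rightarrow> 'a set \<Rightarrow> 'a set \<Rightarrow> ('a \<Rightarrow> nat) \<Rightarrow> ('a \<Rightarrow> nat) \<Rightarrow> nat
      \<Rightarrow> (nat \<times> side) graph" where
  "colour_relation_complement C V1 V2 p' p'' k =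
     bipartite_complement (colour_relation_graph C V1 V2 p' p'' k)
       ({1..k} \<times> {LeftSide}) ({1..k} \<times> {RightSide})"

text \<open>The algorithm ReconstructSCS, with an arbitrary choice of the maximum matching \<open>N\<close>. The
  sets \<open>V1\<close> and \<open>V2\<close> are arguments only to fix which of the two components is coloured by
  \<open>p'\<close> and which by \<open>p''\<close>.\<close>

inductive reconstruct_scs ::
    "('a, 'b) graph_scheme \<Rightarrow> 'a set set \<Rightarrow> 'a set \<Rightarrow> 'a set
      \<Rightarrow> ('a \<Rightarrow> nat) \<Rightarrow> ('a \<Rightarrow> nat) \<Rightarrow> nat \<Rightarrow> ('a \<Rightarrow> nat) option \<Rightarrow> bool"
  for G C V1 V2 p' p'' k where
  not_possible:
    "reconstruct_scs G C V1 V2 p' p'' k None"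
    if "verts ` connected_components (delete_edges G C) = {V1, V2}"
    and "maximum_matching (colour_relation_complement C V1 V2 p' p'' k) N"
    and "card N < k"
| reconstructed:
    "reconstruct_scs G C V1 V2 p' p'' k (Some p)"
    if "verts ` connected_components (delete_edges G C) = {V1, V2}"
    and "maximum_matching (colour_relation_complement C V1 V2 p' p'' k) N"
    and "\<not> card N < k"
    and "\<And>i j. {(i, LeftSide), (j, RightSide)} \<in> N \<Longrightarrow> \<pi> j = i"
    and "p = (\<lambda>v\<in>verts G. if v \<in> V1 then p' v else \<pi> (p'' v))"

end

theory Submission
  imports Defs
begin

text \<open>If the colour relation graph has no suitable matching, Hall's theorem yields sets \<open>A\<close> and \<open>B\<close>
  of colours with \<open>card A + card B > k\<close> such that every colour of \<open>A\<close> on the left meets every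
  colour of \<open>B\<close> on the right. An edge of \<open>M\<close> cannot join two vertices that are the only ones of
  their colours \<open>a \<in> A\<close> and \<open>b \<in> B\<close>, so it has an endpoint that is not of this kind. There are
  at most \<open>2 * (card V\<^sub>C - card A - card B)\<close> such endpoints, which is too few for \<open>M\<close>. So the
  algorithm finds a permutation \<open>\<pi>\<close> of the colours after which all edges of \<open>C\<close> are cut. These
  edges have positive weight, hence no \<open>k\<close>-partition can do better on \<open>C\<close>, nor on the two sides.\<close>

subsection \<open>Matchings and Hall's theorem\<close>

text \<open>The induction of Halmos and Vaughan: split at a critical subset if there is a proper one, and
  otherwise match one index arbitrarily.\<close>

theorem Hall:
  assumes "finite I" "\<And>i. i \<in> I \<Longrightarrow> finite (F i)"
    and "\<And>J. J \<subseteq> I \<Longrightarrow> card J \<le> card (\<Union>(F ` J))"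
  shows "\<exists>f. inj_on f I \<and> (\<forall>i\<in>I. f i \<in> F i)"
  using assms
proof (induction "card I" arbitrary: I F rule: less_induct)
  case less
  note fin = less.prems(1,2) and hall = less.prems(3)
  consider "I = {}" | J where "J \<subset> I" "J \<noteq> {}" "card (\<Union>(F ` J)) = card J"
    | "I \<noteq> {}" "\<And>J. J \<subset> I \<Longrightarrow> J \<noteq> {} \<Longrightarrow> card J < card (\<Union>(F ` J))"
    using hall by (metis le_neq_implies_less psubset_imp_subset)
  then show ?case
  proof cases
    case 1
    then show ?thesis by simp
  next
    case (2 J)
    define U where "U = \<Union>(F ` J)"
    have finJ: "finite J" using 2(1) fin(1) by (meson finite_subset psubset_imp_subset)
    then have finU: "finite U" using 2(1) fin(2) by (auto simp: U_def)
    have "card J < card I" "card (I - J) < card I"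
      using 2 fin(1) finJ by (auto intro!: psubset_card_mono)
    note IH = less.hyps[OF this(1)] less.hyps[OF this(2)]
    have "\<exists>f. inj_on f J \<and> (\<forall>i\<in>J. f i \<in> F i)"
      using 2 fin finJ hall by (intro IH(1)) auto
    then obtain f where f: "inj_on f J" "\<And>i. i \<in> J \<Longrightarrow> f i \<in> F i" by blast
    have "\<exists>g. inj_on g (I - J) \<and> (\<forall>i\<in>I - J. g i \<in> F i - U)"
    proof (intro IH(2))
      fix K assume K: "K \<subseteq> I - J"
      then have finK: "finite K" using fin(1) by (meson finite_Diff finite_subset)
      \<comment> \<open>Hall's condition survives the removal of \<open>U\<close>: apply it to
        \<open>K \<union> J\<close> and cancel \<open>J\<close>, since \<open>J\<close> is critical
        and so \<open>card U = card J\<close>.\<close>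
      have "card K + card J = card (K \<union> J)"
        using K finK finJ by (subst card_Un_disjoint) auto
      also have "\<dots> \<le> card (\<Union>(F ` (K \<union> J)))" using K 2 by (intro hall) auto
      also have "\<Union>(F ` (K \<union> J)) = \<Union>((\<lambda>i. F i - U) ` K) \<union> U" by (auto simp: U_def)
      also have "card \<dots> = card (\<Union>((\<lambda>i. F i - U) ` K)) + card U"
        using K fin(2) finK finU by (subst card_Un_disjoint) auto
      finally show "card K \<le> card (\<Union>((\<lambda>i. F i - U) ` K))"
        using 2(3) by (simp add: U_def)
    qed (use fin in auto)
    then obtain g where g: "inj_on g (I - J)" "\<And>i. i \<in> I - J \<Longrightarrow> g i \<in> F i - U" by blast
    have sep: "f i \<noteq> g j" if "i \<in> J" "j \<in> I - J" for i j
      using f(2)[OF that(1)] g(2)[OF that(2)] that(1) by (auto simp: U_def)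
    define h where "h i = (if i \<in> J then f i else g i)" for i
    have "inj_on h I"
    proof (rule inj_onI)
      fix i j assume "i \<in> I" "j \<in> I" "h i = h j"
      then show "i = j"
        using sep[of i j] sep[of j i] inj_onD[OF f(1), of i j] inj_onD[OF g(1), of i j]
        by (auto simp: h_def split: if_splits)
    qed
    moreover have "\<forall>i\<in>I. h i \<in> F i" using f(2) g(2) by (auto simp: h_def)
    ultimately show ?thesis by blast
  next
    case 3
    then obtain a where a: "a \<in> I" by blast
    then have "F a \<noteq> {}" using hall[of "{a}"] by auto
    then obtain y where y: "y \<in> F a" by blast
    have "\<exists>g. inj_on g (I - {a}) \<and> (\<forall>i\<in>I - {a}. g i \<in> F i - {y})"
    proof (rule less.hyps)
      show "card (I - {a}) < card I" using a fin(1) by (meson card_Diff1_less)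
      fix K assume K: "K \<subseteq> I - {a}"
      show "card K \<le> card (\<Union>((\<lambda>i. F i - {y}) ` K))"
      proof (cases "K = {}")
        case False
        then have "card K < card (\<Union>(F ` K))" using K a by (intro 3(2)) auto
        \<comment> \<open>Deleting \<open>y\<close> costs at most one element, which the strict
          inequality pays for.\<close>
        moreover have "card (\<Union>(F ` K)) - 1 \<le> card (\<Union>(F ` K) - {y})"
          by (simp add: card_Diff_singleton_if)
        moreover have "card (\<Union>(F ` K) - {y}) = card (\<Union>((\<lambda>i. F i - {y}) ` K))"
          by (rule arg_cong[where f = card]) auto
        ultimately show ?thesis by linarith
      qed simp
    qed (use fin in auto)
    then obtain g where g: "inj_on g (I - {a})" "\<And>i. i \<in> I - {a} \<Longrightarrow> g i \<in> F i - {y}" by blast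
    have "inj_on (g(a := y)) I"
    proof (rule inj_onI)
      fix i j assume "i \<in> I" "j \<in> I" "(g(a := y)) i = (g(a := y)) j"
      then show "i = j"
        using g(2)[of i] g(2)[of j] inj_onD[OF g(1), of i j] by (auto split: if_splits)
    qed
    moreover have "\<forall>i\<in>I. (g(a := y)) i \<in> F i" using g(2) y by auto
    ultimately show ?thesis by blast
  qed
qed

text \<open>Choosing a point of \<open>U\<close> in each member is injective because the members are
  disjoint. This serves twice: to bound \<open>M\<close> by the vertices that are not uniquely
  coloured, and \<open>N\<close> by the matched right colours.\<close>

lemma card_disjoint_family_le:
  assumes "finite U" "\<And>e. e \<in> M \<Longrightarrow> e \<inter> U \<noteq> {}"
    and "\<And>e f. e \<in> M \<Longrightarrow> f \<in> M \<Longrightarrow> e \<noteq> f \<Longrightarrow> e \<inter> f = {}"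
  shows "card M \<le> card U"
proof -
  have "\<exists>r. \<forall>e\<in>M. r e \<in> e \<inter> U" using assms(2) by (intro bchoice) blast
  then obtain r where r: "\<And>e. e \<in> M \<Longrightarrow> r e \<in> e \<inter> U" by blast
  have "inj_on r M"
  proof (rule inj_onI)
    fix e f assume "e \<in> M" "f \<in> M" "r e = r f"
    then show "e = f" using r[of e] r[of f] assms(3)[of e f] by auto
  qed
  moreover have "r ` M \<subseteq> U" using r by auto
  ultimately show ?thesis using assms(1) by (rule card_inj_on_le)
qed

subsection \<open>The colour relation graph\<close>

text \<open>Pick one representative for each colour of \<open>A\<close>; the remaining elements form
  \<open>W\<close>, of size \<open>card S - card A\<close>. A representative is counted only if it
  shares its colour with an element of \<open>W\<close>, and each element of \<open>W\<close> spoils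
  at most one representative. Hence the factor 2.\<close>

lemma card_nonunique_colour_le:
  assumes "finite S" "A \<subseteq> f ` S"
  shows "card {x \<in> S. \<not> (f x \<in> A \<and> (\<forall>y\<in>S. f y = f x \<longrightarrow> y = x))} \<le> 2 * (card S - card A)"
    (is "card ?U \<le> _")
proof -
  define g where "g = inv_into S f"
  have g: "g a \<in> S \<and> f (g a) = a" if "a \<in> A" for a
    using assms(2) that by (auto simp: g_def f_inv_into_f intro: inv_into_into)
  have inj: "inj_on g A" by (metis g inj_onI)
  define W where "W = S - g ` A"
  have finW: "finite W" using assms(1) by (simp add: W_def)
  have cardW: "card W = card S - card A"
    unfolding W_def using assms g card_image[OF inj]
    by (subst card_Diff_subset) (auto intro: finite_subset[OF _ assms(1)])
  have "?U \<subseteq> W \<union> g ` f ` W"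
  proof
    fix x assume x: "x \<in> ?U"
    show "x \<in> W \<union> g ` f ` W"
    proof (cases "x \<in> W")
      case False
      then obtain a where a: "a \<in> A" "x = g a" using x by (auto simp: W_def)
      then obtain y where y: "y \<in> S" "f y = a" "y \<noteq> x" using x g[OF a(1)] by auto
      then have "y \<in> W" using a g by (auto simp: W_def)
      then show ?thesis using a y by auto
    qed simp
  qed
  then have "card ?U \<le> card (W \<union> g ` f ` W)" using finW by (intro card_mono) auto
  also have "\<dots> \<le> card W + card (g ` f ` W)" by (rule card_Un_le)
  also have "\<dots> \<le> 2 * card W"
    using card_image_le[of "f ` W" g] card_image_le[of W f] finW by simp
  finally show ?thesis by (simp add: cardW)
qed

text \<open>If \<open>x\<close> and \<open>y\<close> are the only vertices on their sides with
  colours \<open>a \<in> A\<close> and \<open>b \<in> B\<close>, the edge of \<open>C\<close> that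
  realises this pair of colours must be \<open>{x, y}\<close>, which is therefore not in
  \<open>M\<close>. So every edge of \<open>M\<close> meets \<open>UL \<union> UR\<close>, and
  disjointness turns this into a bound.\<close>

lemma complete_colour_pair_le:
  assumes fin: "finite L" "finite R"
    and pairs: "\<And>a b. a \<in> A \<Longrightarrow> b \<in> B \<Longrightarrow> \<exists>x\<in>L. \<exists>y\<in>R. {x, y} \<in> C \<and> p x = a \<and> q y = b"
    and ne: "A \<noteq> {}" "B \<noteq> {}"
    and M: "\<And>e. e \<in> M \<Longrightarrow> \<exists>x\<in>L. \<exists>y\<in>R. e = {x, y} \<and> {x, y} \<notin> C"
    and disj: "\<And>e f. e \<in> M \<Longrightarrow> f \<in> M \<Longrightarrow> e \<noteq> f \<Longrightarrow> e \<inter> f = {}"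
  shows "card A + card B \<le> card L + card R"
    and "card M + 2 * (card A + card B) \<le> 2 * (card L + card R)"
proof -
  have A: "A \<subseteq> p ` L" using pairs ne(2) by blast
  have B: "B \<subseteq> q ` R" using pairs ne(1) by blast
  \<comment> \<open>These bounds make the truncated subtractions exact in the last step.\<close>
  have le: "card A \<le> card L" "card B \<le> card R"
    using A B fin by (auto intro: surj_card_le)
  then show "card A + card B \<le> card L + card R" by simp
  define UL where "UL = {x \<in> L. \<not> (p x \<in> A \<and> (\<forall>y\<in>L. p y = p x \<longrightarrow> y = x))}"
  define UR where "UR = {x \<in> R. \<not> (q x \<in> B \<and> (\<forall>y\<in>R. q y = q x \<longrightarrow> y = x))}"
  have "card M \<le> card (UL \<union> UR)"
  proof (rule card_disjoint_family_le)
    fix e assume "e \<in> M"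
    then obtain x y where xy: "x \<in> L" "y \<in> R" "e = {x, y}" "{x, y} \<notin> C" using M by blast
    have "x \<in> UL \<or> y \<in> UR"
    proof (rule ccontr)
      assume "\<not> (x \<in> UL \<or> y \<in> UR)"
      then have uniq: "p x \<in> A" "\<And>z. z \<in> L \<Longrightarrow> p z = p x \<Longrightarrow> z = x"
        "q y \<in> B" "\<And>z. z \<in> R \<Longrightarrow> q z = q y \<Longrightarrow> z = y"
        using xy by (auto simp: UL_def UR_def)
      then obtain u v where "u \<in> L" "v \<in> R" "{u, v} \<in> C" "p u = p x" "q v = q y"
        using pairs[of "p x" "q y"] by blast
      then show False using uniq xy(4) by metis
    qed
    then show "e \<inter> (UL \<union> UR) \<noteq> {}" using xy(3) by auto
  qed (use fin disj in \<open>auto simp: UL_def UR_def\<close>)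
  also have "\<dots> \<le> card UL + card UR" by (rule card_Un_le)
  also have "\<dots> \<le> 2 * (card L - card A) + 2 * (card R - card B)"
    unfolding UL_def UR_def
    by (intro add_mono card_nonunique_colour_le fin A B)
  finally show "card M + 2 * (card A + card B) \<le> 2 * (card L + card R)" using le by simp
qed

text \<open>Hall's theorem assigns to each left colour a right colour that it never meets along
  \<open>C\<close>. Here \<open>\<sigma>\<close> runs from left to right, opposite to the
  \<open>\<pi>\<close> of the algorithm. The guard \<open>p x \<in> {1..k}\<close> allows
  \<open>p\<close> and \<open>q\<close> to be arbitrary functions.\<close>

lemma compatible_recolouring_exists:
  fixes p q :: "'a \<Rightarrow> nat"
  assumes "finite L" "finite R"
    and "\<And>e. e \<in> M \<Longrightarrow> \<exists>x\<in>L. \<exists>y\<in>R. e = {x, y} \<and> {x, y} \<notin> C"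
    and "\<And>e f. e \<in> M \<Longrightarrow> f \<in> M \<Longrightarrow> e \<noteq> f \<Longrightarrow> e \<inter> f = {}"
    and size: "int (card M) \<ge> 2 * (int (card L + card R) - int k) - 1"
  shows "\<exists>\<sigma>. inj_on \<sigma> {1..k} \<and> \<sigma> ` {1..k} \<subseteq> {1..k} \<and>
    (\<forall>x\<in>L. \<forall>y\<in>R. {x, y} \<in> C \<longrightarrow> p x \<in> {1..k} \<longrightarrow> \<sigma> (p x) \<noteq> q y)"
proof -
  define F where "F a = {b \<in> {1..k}. \<forall>x\<in>L. \<forall>y\<in>R. {x, y} \<in> C \<longrightarrow> p x = a \<longrightarrow> q y \<noteq> b}" for a
  have "\<exists>\<sigma>. inj_on \<sigma> {1..k} \<and> (\<forall>i\<in>{1..k}. \<sigma> i \<in> F i)"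
  proof (rule Hall)
    fix A assume A: "A \<subseteq> {1..k}"
    \<comment> \<open>A colour belongs to \<open>B\<close> exactly if it clashes with every colour
      of \<open>A\<close>.\<close>
    define B where "B = {1..k} - \<Union>(F ` A)"
    have sub: "\<Union>(F ` A) \<subseteq> {1..k}" by (auto simp: F_def)
    then have card_B: "card B = k - card (\<Union>(F ` A))"
      unfolding B_def by (subst card_Diff_subset) (auto intro: finite_subset)
    have le: "card A \<le> k" "card (\<Union>(F ` A)) \<le> k"
      using card_mono[OF _ A] card_mono[OF _ sub] by auto
    show "card A \<le> card (\<Union>(F ` A))"
    proof (rule ccontr)
      assume "\<not> ?thesis"
      then have gt: "card A + card B > k" "card A > 0" "card B > 0"
        using card_B le by auto
      then have ne: "A \<noteq> {}" "B \<noteq> {}" by auto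
      have "\<exists>x\<in>L. \<exists>y\<in>R. {x, y} \<in> C \<and> p x = a \<and> q y = b" if "a \<in> A" "b \<in> B" for a b
        using that by (auto simp: B_def F_def)
      note le = complete_colour_pair_le[where M = M, OF assms(1,2) this ne assms(3,4)]
      \<comment> \<open>As \<open>card A + card B \<ge> k + 1\<close>, the count leaves at most
        \<open>2 * (card L + card R - k) - 2\<close> edges for \<open>M\<close>, one fewer than
        \<open>size\<close> demands.\<close>
      show False using le gt(1) size by simp
    qed
  qed (auto simp: F_def)
  then obtain \<sigma> where "inj_on \<sigma> {1..k}" "\<And>i. i \<in> {1..k} \<Longrightarrow> \<sigma> i \<in> F i" by blast
  then show ?thesis by (intro exI[of _ \<sigma>]) (fastforce simp: F_def)
qed

section \<open>Matchings of colours and the permutations they encode\<close>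

lemma colour_complement_edge_iff:
  "e \<in> edges (colour_relation_complement C V1 V2 p q k) \<longleftrightarrow>
    (\<exists>i\<in>{1..k}. \<exists>j\<in>{1..k}. e = {(i, LeftSide), (j, RightSide)} \<and>
       \<not> (\<exists>x\<in>V1. \<exists>y\<in>V2. {x, y} \<in> C \<and> p x = i \<and> q y = j))"
  by (auto simp: colour_relation_complement_def colour_relation_graph_def
      bipartite_complement_def doubleton_eq_iff) blast

text \<open>The graph of \<open>\<sigma>\<close>, drawn between the two copies of the colours, is
  the matching; injectivity keeps its edges disjoint on the right.\<close>

lemma colour_complement_matching_exists:
  assumes "inj_on \<sigma> {1..k}" "\<sigma> ` {1..k} \<subseteq> {1..k}"
    and "\<And>x y. x \<in> V1 \<Longrightarrow> y \<in> V2 \<Longrightarrow> {x, y} \<in> C \<Longrightarrow> p x \<in> {1..k} \<Longrightarrow> \<sigma> (p x) \<noteq> q y"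
  shows "\<exists>N. matching (colour_relation_complement C V1 V2 p q k) N \<and> card N = k"
proof (intro exI conjI)
  define h where "h i = {(i, LeftSide), (\<sigma> i, RightSide)}" for i
  have inj: "inj_on h {1..k}" by (auto simp: h_def doubleton_eq_iff intro: inj_onI)
  then show "card (h ` {1..k}) = k" by (simp add: card_image)
  have "h i \<in> edges (colour_relation_complement C V1 V2 p q k)" if "i \<in> {1..k}" for i
  proof -
    have "\<sigma> i \<in> {1..k}" using that assms(2) by blast
    moreover have "\<not> (\<exists>x\<in>V1. \<exists>y\<in>V2. {x, y} \<in> C \<and> p x = i \<and> q y = \<sigma> i)"
      using assms(3) that by fastforce
    ultimately show ?thesis
      unfolding colour_complement_edge_iff using that h_def by (intro bexI[of _ i] bexI[of _ "\<sigma> i"] conjI) simp_all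
  qed
  moreover have "h i \<inter> h j = {}" if "i \<in> {1..k}" "j \<in> {1..k}" "h i \<noteq> h j" for i j
  proof -
    have "i \<noteq> j" using that by auto
    then have "\<sigma> i \<noteq> \<sigma> j" using inj_onD[OF assms(1)] that by blast
    then show ?thesis using \<open>i \<noteq> j\<close> by (simp add: h_def)
  qed
  ultimately show "matching (colour_relation_complement C V1 V2 p q k) (h ` {1..k})"
    unfolding matching_def by blast
qed

text \<open>There are finitely many matchings, the empty one among them. This lets the algorithm
  reach a result at all.\<close>

lemma maximum_matching_exists:
  assumes "finite (edges G)"
  shows "\<exists>N. maximum_matching G N"
proof -
  have "{N. matching G N} \<subseteq> Pow (edges G)" by (auto simp: matching_def)
  then have fin: "finite {N. matching G N}" using assms by (meson finite_Pow_iff finite_subset)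
  moreover have "matching G {}" by (simp add: matching_def)
  ultimately have "Max (card ` {N. matching G N}) \<in> card ` {N. matching G N}"
    by (intro Max_in) auto
  then obtain N where "matching G N" "card N = Max (card ` {N. matching G N})" by auto
  then have "is_arg_max card (matching G) N"
    using fin by (auto simp: is_arg_max_linorder)
  then show ?thesis unfolding maximum_matching_def by blast
qed

lemma finite_colour_complement: "finite (edges (colour_relation_complement C V1 V2 p q k))"
proof (rule finite_subset)
  show "edges (colour_relation_complement C V1 V2 p q k) \<subseteq> Pow ({1..k} \<times> {LeftSide, RightSide})"
    by (auto simp: colour_complement_edge_iff)
qed auto

lemma matching_unique:
  assumes "matching G N" "e \<in> N" "f \<in> N" "x \<in> e" "x \<in> f"
  shows "e = f"
  using assms unfolding matching_def by blast

text \<open>Outside \<open>{1..k}\<close> the function \<open>\<pi>\<close> that is read off a perfect matching is arbitrary.\<close>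

lemma perfect_colour_matching:
  assumes N: "matching (colour_relation_complement C V1 V2 p q k) N" and "k \<le> card N"
  shows "\<exists>\<pi>. \<forall>i j. {(i, LeftSide), (j, RightSide)} \<in> N \<longrightarrow> \<pi> j = i"
    and "\<lbrakk>\<And>i j. {(i, LeftSide), (j, RightSide)} \<in> N \<Longrightarrow> \<pi> j = i\<rbrakk> \<Longrightarrow>
      inj_on \<pi> {1..k} \<and> \<pi> ` {1..k} \<subseteq> {1..k} \<and>
      (\<forall>x\<in>V1. \<forall>y\<in>V2. {x, y} \<in> C \<longrightarrow> q y \<in> {1..k} \<longrightarrow> p x \<noteq> \<pi> (q y))"
proof -
  have edge: "i \<in> {1..k} \<and> j \<in> {1..k} \<and> \<not> (\<exists>x\<in>V1. \<exists>y\<in>V2. {x, y} \<in> C \<and> p x = i \<and> q y = j)"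
    if "{(i, LeftSide), (j, RightSide)} \<in> N" for i j
  proof -
    have "{(i, LeftSide), (j, RightSide)} \<in> edges (colour_relation_complement C V1 V2 p q k)"
      using N that by (auto simp: matching_def)
    then show ?thesis unfolding colour_complement_edge_iff by (auto simp: doubleton_eq_iff)
  qed
  have uniq: "i = i' \<longleftrightarrow> j = j'"
    if "{(i, LeftSide), (j, RightSide)} \<in> N" "{(i', LeftSide), (j', RightSide)} \<in> N" for i j i' j'
    using matching_unique[OF N that, of "(i, LeftSide)"]
      matching_unique[OF N that, of "(j, RightSide)"]
    by (auto simp: doubleton_eq_iff)
  \<comment> \<open>Each right colour lies in at most one edge of \<open>N\<close>, so the
    description is unique wherever such an edge exists.\<close>
  define \<rho> where "\<rho> j = (THE i. {(i, LeftSide), (j, RightSide)} \<in> N)" for j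
  have "\<rho> j = i" if "{(i, LeftSide), (j, RightSide)} \<in> N" for i j
    unfolding \<rho>_def using that uniq by blast
  then show "\<exists>\<pi>. \<forall>i j. {(i, LeftSide), (j, RightSide)} \<in> N \<longrightarrow> \<pi> j = i" by blast
  \<comment> \<open>\<open>T\<close> collects the matched right colours. Each edge of
    \<open>N\<close> occupies one of its own, so \<open>k \<le> card N\<close> forces
    \<open>T\<close> to be all of \<open>{1..k}\<close>.\<close>
  define T where "T = {j \<in> {1..k}. \<exists>i. {(i, LeftSide), (j, RightSide)} \<in> N}"
  have "card N \<le> card (T \<times> {RightSide})"
  proof (rule card_disjoint_family_le)
    fix e assume e: "e \<in> N"
    then have "e \<in> edges (colour_relation_complement C V1 V2 p q k)"
      using N by (auto simp: matching_def)
    then obtain i j where "i \<in> {1..k}" "j \<in> {1..k}" "e = {(i, LeftSide), (j, RightSide)}"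
      unfolding colour_complement_edge_iff by blast
    then have "(j, RightSide) \<in> e \<inter> (T \<times> {RightSide})" using e by (auto simp: T_def)
    then show "e \<inter> (T \<times> {RightSide}) \<noteq> {}" by blast
  qed (use N in \<open>auto simp: T_def matching_def\<close>)
  then have "card {1..k} \<le> card T" using \<open>k \<le> card N\<close> by (simp add: card_cartesian_product)
  then have "T = {1..k}" by (intro card_seteq) (auto simp: T_def)
  then have ex: "\<exists>i. {(i, LeftSide), (j, RightSide)} \<in> N" if "j \<in> {1..k}" for j
    using that unfolding T_def by blast
  assume \<pi>: "\<And>i j. {(i, LeftSide), (j, RightSide)} \<in> N \<Longrightarrow> \<pi> j = i"
  have \<pi>N: "{(\<pi> j, LeftSide), (j, RightSide)} \<in> N" if "j \<in> {1..k}" for j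
    using ex[OF that] \<pi> by blast
  have "inj_on \<pi> {1..k}"
    using uniq[OF \<pi>N \<pi>N] by (auto intro: inj_onI)
  moreover have "\<pi> ` {1..k} \<subseteq> {1..k}" using edge[OF \<pi>N] by blast
  moreover have "\<forall>x\<in>V1. \<forall>y\<in>V2. {x, y} \<in> C \<longrightarrow> q y \<in> {1..k} \<longrightarrow> p x \<noteq> \<pi> (q y)"
    using edge[OF \<pi>N] by blast
  ultimately show "inj_on \<pi> {1..k} \<and> \<pi> ` {1..k} \<subseteq> {1..k} \<and>
      (\<forall>x\<in>V1. \<forall>y\<in>V2. {x, y} \<in> C \<longrightarrow> q y \<in> {1..k} \<longrightarrow> p x \<noteq> \<pi> (q y))" by blast
qed

subsection \<open>Splitting a graph along a cut set\<close>

lemma simple_graph_edgeE: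
  assumes "simple_graph G" "e \<in> edges G"
  obtains x y where "e = {x, y}" "x \<noteq> y" "x \<in> verts G" "y \<in> verts G"
proof -
  have "card e = 2" "e \<subseteq> verts G" using assms by (simp_all add: simple_graph_def)
  then show thesis using that by (auto simp: card_2_iff)
qed

lemma finite_edges: "simple_graph G \<Longrightarrow> finite (edges G)"
  unfolding simple_graph_def by (rule finite_subset[of _ "Pow (verts G)"]) auto

lemma equiv_connected_rel: "equiv (verts G) (connected_rel G)"
proof (rule equivI)
  show "connected_rel G \<subseteq> verts G \<times> verts G" by (auto simp: connected_rel_def)
  show "refl_on (verts G) (connected_rel G)"
    by (auto simp: refl_on_def connected_rel_def)
  have "sym {(a, b). {a, b} \<in> edges G}" by (auto simp: sym_def insert_commute)
  then have "sym ({(a, b). {a, b} \<in> edges G}\<^sup>*)" by (rule sym_rtrancl)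
  then show "sym (connected_rel G)" by (auto simp: connected_rel_def sym_def)
  show "trans (connected_rel G)"
    by (auto simp: connected_rel_def trans_def)
qed

text \<open>An edge between \<open>S\<close> and its complement belongs to the cut and is deleted,
  so no remaining path changes sides.\<close>

lemma connected_rel_cut:
  assumes "(x, y) \<in> connected_rel (delete_edges G (cut G S))"
  shows "x \<in> S \<longleftrightarrow> y \<in> S"
proof -
  have "(x, y) \<in> {(a, b). {a, b} \<in> edges G - cut G S}\<^sup>*"
    using assms by (simp add: connected_rel_def delete_edges_def)
  then show ?thesis
  proof (induction rule: rtrancl_induct)
    case (step y z)
    then have "y \<in> S \<longleftrightarrow> z \<in> S" unfolding cut_def by (auto simp: insert_commute)
    with step.IH show ?case by simp
  qed simp
qed

text \<open>What the later arguments use of the decomposition, freed of quotients and of the set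
  \<open>S\<close> that induces the cut.\<close>

locale split_graph =
  fixes G G1 G2 :: "'a wgraph" and C :: "'a set set"
  assumes simple: "simple_graph G"
    and verts_Un: "verts G = verts G1 \<union> verts G2" and verts_disj: "verts G1 \<inter> verts G2 = {}"
    and edges_Un: "edges G = edges G1 \<union> edges G2 \<union> C"
    and edges_sub: "\<And>e. e \<in> edges G1 \<Longrightarrow> e \<subseteq> verts G1" "\<And>e. e \<in> edges G2 \<Longrightarrow> e \<subseteq> verts G2"
    and crossing: "\<And>e. e \<in> C \<Longrightarrow> \<exists>x\<in>verts G1. \<exists>y\<in>verts G2. e = {x, y}"
    and weights: "weight G1 = weight G" "weight G2 = weight G"
    and positive: "\<And>e. e \<in> C \<Longrightarrow> weight G e > 0"

text \<open>The components are the only two classes of an equivalence relation, so they partition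
  the vertices. A remaining edge stays within one class, while an edge of \<open>C\<close> joins
  opposite sides of \<open>S\<close> and hence the two different classes.\<close>

lemma split_graphI:
  fixes G G1 G2 :: "'a wgraph"
  assumes simple: "simple_graph G" and C: "positive_cut_set G C"
    and comps: "connected_components (delete_edges G C) = {G1, G2}" "G1 \<noteq> G2"
  shows "split_graph G G1 G2 C"
proof -
  let ?H = "delete_edges G C"
  obtain S where S: "C = cut G S" and pos: "\<And>e. e \<in> C \<Longrightarrow> weight G e > 0"
    using C by (auto simp: positive_cut_set_def cut_set_def)
  have H: "verts ?H = verts G" "edges ?H = edges G - C" "weight ?H = weight G"
    by (simp_all add: delete_edges_def)
  have ind: "K = induced_subgraph ?H (verts K) \<and> verts K \<in> verts G // connected_rel ?H"
    if "K \<in> {G1, G2}" for K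
    using that unfolding comps(1)[symmetric] connected_components_def H(1)
    by (auto simp: induced_subgraph_def)
  then have G12: "G1 = induced_subgraph ?H (verts G1)" "G2 = induced_subgraph ?H (verts G2)"
    and q: "verts G1 \<in> verts G // connected_rel ?H" "verts G2 \<in> verts G // connected_rel ?H"
    by blast+
  have eq: "equiv (verts G) (connected_rel ?H)" using equiv_connected_rel[of ?H] H(1) by simp
  \<comment> \<open>The hypothesis distinguishes the graphs; a component is determined by its vertex
    set, so these differ too.\<close>
  have "verts G1 \<noteq> verts G2" using G12 comps(2) by metis
  then have disj: "verts G1 \<inter> verts G2 = {}" using quotient_disj[OF eq q] by blast
  have "verts ` connected_components ?H = verts G // connected_rel ?H"
    unfolding connected_components_def H(1) by (force simp: induced_subgraph_def image_iff)
  then have "verts G // connected_rel ?H = {verts G1, verts G2}" using comps(1) by simp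
  then have Un: "verts G = verts G1 \<union> verts G2" using Union_quotient[OF eq] by simp
  have e1: "edges G1 = {e \<in> edges G - C. e \<subseteq> verts G1}"
    by (subst G12(1)) (simp add: induced_subgraph_def H(2))
  have e2: "edges G2 = {e \<in> edges G - C. e \<subseteq> verts G2}"
    by (subst G12(2)) (simp add: induced_subgraph_def H(2))
  have rel: "(x, y) \<in> connected_rel ?H \<longleftrightarrow> x \<in> verts G1 \<and> y \<in> verts G1 \<or> x \<in> verts G2 \<and> y \<in> verts G2"
    if "x \<in> verts G" "y \<in> verts G" for x y
    using that Un disj quotient_eq_iff[OF eq q(1) q(1), of x y] quotient_eq_iff[OF eq q(1) q(2), of x y]
      quotient_eq_iff[OF eq q(2) q(1), of x y] quotient_eq_iff[OF eq q(2) q(2), of x y]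
    by blast
  have edges: "edges G - C \<subseteq> edges G1 \<union> edges G2"
  proof
    fix e assume e: "e \<in> edges G - C"
    then obtain x y where xy: "e = {x, y}" "x \<in> verts G" "y \<in> verts G"
      using simple by (auto elim: simple_graph_edgeE)
    then have "(x, y) \<in> connected_rel ?H" using e by (auto simp: connected_rel_def H)
    then show "e \<in> edges G1 \<union> edges G2" using rel[OF xy(2,3)] e xy(1) by (auto simp: e1 e2)
  qed
  have cross: "\<exists>x\<in>verts G1. \<exists>y\<in>verts G2. e = {x, y}" if "e \<in> C" for e
  proof -
    have "e \<in> cut G S" using that S by simp
    then obtain s t where st: "e = {s, t}" "s \<in> S" "t \<notin> S" "e \<in> edges G"
      unfolding cut_def by blast
    then have V: "s \<in> verts G" "t \<in> verts G"
      using simple by (auto simp: simple_graph_def)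
    have "(s, t) \<notin> connected_rel ?H" using connected_rel_cut[of s t G S] st by (auto simp: S)
    then show ?thesis using rel[OF V] V Un st(1) by (auto simp: insert_commute)
  qed
  have "C \<subseteq> edges G" by (auto simp: S cut_def)
  then have "edges G = edges G1 \<union> edges G2 \<union> C" using edges by (auto simp: e1 e2)
  moreover have "weight G1 = weight G" by (subst G12(1)) (simp add: induced_subgraph_def H)
  moreover have "weight G2 = weight G" by (subst G12(2)) (simp add: induced_subgraph_def H)
  ultimately show ?thesis
    using simple Un disj cross pos by unfold_locales (auto simp: e1 e2)
qed

text \<open>The weight depends only on which vertices share a colour. So it is invariant under
  injective recolouring and under restriction of the partition to the vertex set.\<close>

lemma partition_weight_cong:
  assumes "simple_graph G"
    and "\<And>x y. x \<in> verts G \<Longrightarrow> y \<in> verts G \<Longrightarrow> p x = p y \<longleftrightarrow> q x = q y"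
  shows "partition_weight G p = partition_weight G q"
proof -
  have "{e \<in> edges G. \<exists>x y. e = {x, y} \<and> p x \<noteq> p y} = {e \<in> edges G. \<exists>x y. e = {x, y} \<and> q x \<noteq> q y}"
  proof (intro Collect_cong conj_cong[OF refl] ex_cong1)
    fix e x y assume "e \<in> edges G" "e = {x, y}"
    then have "{x, y} \<subseteq> verts G" using assms(1) by (auto simp: simple_graph_def)
    then show "p x \<noteq> p y \<longleftrightarrow> q x \<noteq> q y" using assms(2) by simp
  qed
  then show ?thesis unfolding partition_weight_def by simp
qed

section \<open>Maximum cuts of a split graph\<close>

context split_graph
begin

lemma simple_parts: "simple_graph G1" "simple_graph G2"
  using simple verts_Un edges_Un edges_sub by (auto simp: simple_graph_def)

lemma partition_weight_split:
  "partition_weight G p = partition_weight G1 p + partition_weight G2 p +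
     (\<Sum>e\<in>{e \<in> C. \<exists>x y. e = {x, y} \<and> p x \<noteq> p y}. weight G e)"
proof -
  let ?c = "\<lambda>E. {e \<in> E. \<exists>x y. e = {x, y} \<and> p x \<noteq> p y}"
  have fin: "finite (edges G1)" "finite (edges G2)" "finite C"
    using finite_edges[OF simple] by (simp_all add: edges_Un)
  have "edges G1 \<inter> edges G2 = {}"
  proof -
    \<comment> \<open>Since the vertex sets are disjoint, only the empty set could be an edge of
      both parts.\<close>
    have "e \<noteq> {}" if "e \<in> edges G1" for e
      using simple_parts(1) that by (auto elim: simple_graph_edgeE)
    then show ?thesis using edges_sub verts_disj by blast
  qed
  moreover have "(edges G1 \<union> edges G2) \<inter> C = {}"
  proof -
    have "\<not> e \<subseteq> verts G1 \<and> \<not> e \<subseteq> verts G2" if "e \<in> C" for e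
      using crossing[OF that] verts_disj by auto
    then show ?thesis using edges_sub by blast
  qed
  moreover have "?c (edges G) = ?c (edges G1) \<union> ?c (edges G2) \<union> ?c C"
    by (auto simp: edges_Un)
  ultimately show ?thesis
    unfolding partition_weight_def weights using fin
    by (simp add: sum.union_disjoint disjoint_iff)
qed

text \<open>All three summands of \<open>partition_weight_split\<close> are maximal at
  \<open>p\<close>: the first two by optimality of \<open>p1\<close> and \<open>p2\<close>, where
  \<open>\<pi>\<close> preserves the weight by injectivity, and the third because every edge of
  \<open>C\<close> is cut and has positive weight.\<close>

lemma optimum_recoloured:
  assumes p1: "optimum_max_k_cut k G1 p1" and p2: "optimum_max_k_cut k G2 p2"
    and inj: "inj_on \<pi> {1..k}"
    and p: "k_partition k (verts G) p" "\<And>v. v \<in> verts G1 \<Longrightarrow> p v = p1 v"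
      "\<And>v. v \<in> verts G2 \<Longrightarrow> p v = \<pi> (p2 v)"
    and proper: "\<And>x y. x \<in> verts G1 \<Longrightarrow> y \<in> verts G2 \<Longrightarrow> {x, y} \<in> C \<Longrightarrow> p x \<noteq> p y"
  shows "optimum_max_k_cut k G p"
proof -
  let ?c = "\<lambda>q. \<Sum>e\<in>{e \<in> C. \<exists>x y. e = {x, y} \<and> q x \<noteq> q y}. weight G e"
  have finC: "finite C" using finite_edges[OF simple] by (simp add: edges_Un)
  have opt1: "partition_weight G1 q \<le> partition_weight G1 p1" if "k_partition k (verts G1) q" for q
    using p1 that by (auto simp: optimum_max_k_cut_def is_arg_max_linorder)
  have opt2: "partition_weight G2 q \<le> partition_weight G2 p2" if "k_partition k (verts G2) q" for q
    using p2 that by (auto simp: optimum_max_k_cut_def is_arg_max_linorder)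
  have p2V: "p2 v \<in> {1..k}" if "v \<in> verts G2" for v
    using p2 that by (auto simp: optimum_max_k_cut_def is_arg_max_linorder k_partition_def)
  have w1: "partition_weight G1 p = partition_weight G1 p1"
    using p(2) by (intro partition_weight_cong simple_parts) auto
  have w2: "partition_weight G2 p = partition_weight G2 p2"
    using p(3) p2V inj_on_eq_iff[OF inj] by (intro partition_weight_cong simple_parts) auto
  have "{e \<in> C. \<exists>x y. e = {x, y} \<and> p x \<noteq> p y} = C"
    using crossing proper by blast
  then have wC: "?c p = sum (weight G) C" by simp
  have "partition_weight G q \<le> partition_weight G p" if q: "k_partition k (verts G) q" for q
  proof -
    \<comment> \<open>Partitions are extensional functions, so \<open>q\<close> is restricted before
      it competes with \<open>p1\<close> on \<open>G1\<close>.\<close>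
    have "partition_weight G1 q = partition_weight G1 (restrict q (verts G1))"
      by (intro partition_weight_cong simple_parts) auto
    also have "\<dots> \<le> partition_weight G1 p"
      unfolding w1 using q by (intro opt1) (auto simp: k_partition_def verts_Un)
    finally have 1: "partition_weight G1 q \<le> partition_weight G1 p" .
    have "partition_weight G2 q = partition_weight G2 (restrict q (verts G2))"
      by (intro partition_weight_cong simple_parts) auto
    also have "\<dots> \<le> partition_weight G2 p"
      unfolding w2 using q by (intro opt2) (auto simp: k_partition_def verts_Un)
    finally have 2: "partition_weight G2 q \<le> partition_weight G2 p" .
    have "?c q \<le> ?c p"
      unfolding wC using finC positive by (intro sum_mono2) (auto simp: less_imp_le)
    with 1 2 show ?thesis by (simp add: partition_weight_split)
  qed
  then show ?thesis
    using p(1) by (auto simp: optimum_max_k_cut_def is_arg_max_linorder)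
qed

text \<open>Edges of \<open>G1\<close> and \<open>G2\<close> stay on their own side, so an edge of
  \<open>G\<close> between the sides lies in \<open>C\<close>.\<close>

lemma boundary_parts:
  "boundary G (verts G1) = {x \<in> verts G1. \<exists>y\<in>verts G2. {x, y} \<in> C}"
  "boundary G (verts G2) = {y \<in> verts G2. \<exists>x\<in>verts G1. {x, y} \<in> C}"
proof -
  have *: "{x, y} \<in> edges G \<longleftrightarrow> {x, y} \<in> C" if "x \<in> verts G1" "y \<in> verts G2" for x y
    using that verts_disj edges_sub[of "{x, y}"] by (auto simp: edges_Un)
  have "verts G - verts G1 = verts G2" "verts G - verts G2 = verts G1"
    using verts_Un verts_disj by auto
  then show "boundary G (verts G1) = {x \<in> verts G1. \<exists>y\<in>verts G2. {x, y} \<in> C}"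
    "boundary G (verts G2) = {y \<in> verts G2. \<exists>x\<in>verts G1. {x, y} \<in> C}"
    unfolding boundary_def using * by (auto, (metis insert_commute)+)
qed

lemma Union_cut: "\<Union>C = boundary G (verts G1) \<union> boundary G (verts G2)"
  unfolding boundary_parts using crossing by blast

end

section \<open>Correctness of the reconstruction\<close>

theorem theorem17:
  fixes k :: nat and G G1 G2 :: "'a wgraph" and C :: "'a set set" and L R :: "'a set"
    and M :: "'a set set"
  assumes "k \<ge> 1"
    and "weighted_graph G"
    and "positive_cut_set G C"
    and "connected_components (delete_edges G C) = {G1, G2}" and "G1 \<noteq> G2"
    and "L = boundary G (verts G1)" and "R = boundary G (verts G2)"
    and "matching (bipartite_complement (edge_graph C) L R) M"
    and "int (card M) \<ge> 2 * (int (card (verts (edge_graph C))) - int k) - 1"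
  shows "optimality_preserving_data_separation k G [G1, G2]
    (\<lambda>ps. reconstruct_scs G C (verts G1) (verts G2) (ps ! 0) (ps ! 1) k)"
proof -
  interpret split_graph G G1 G2 C
    using assms(2-5) by (intro split_graphI) (auto simp: weighted_graph_def)
  let ?V1 = "verts G1" and ?V2 = "verts G2"
  have comps: "verts ` connected_components (delete_edges G C) = {?V1, ?V2}" using assms(4) by simp
  have LR: "L \<subseteq> ?V1" "R \<subseteq> ?V2" by (auto simp: assms(6,7) boundary_def)
  have "finite (verts G)" using simple by (simp add: simple_graph_def)
  then have fin: "finite L" "finite R"
    using LR by (auto simp: verts_Un intro: finite_subset)
  \<comment> \<open>The endpoints of \<open>C\<close> are the disjoint union of \<open>L\<close> and
    \<open>R\<close>, which turns the assumed bound into one on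
    \<open>card L + card R\<close>.\<close>
  have size: "int (card M) \<ge> 2 * (int (card L + card R) - int k) - 1"
  proof -
    have "card (verts (edge_graph C)) = card (L \<union> R)"
      using Union_cut by (simp add: edge_graph_def assms(6,7))
    also have "\<dots> = card L + card R"
      using LR verts_disj fin by (intro card_Un_disjoint) auto
    finally show ?thesis using assms(9) by simp
  qed
  have M: "\<exists>x\<in>L. \<exists>y\<in>R. e = {x, y} \<and> {x, y} \<notin> C" if "e \<in> M" for e
  proof -
    have "M \<subseteq> {{x, y} | x y. x \<in> L \<and> y \<in> R \<and> {x, y} \<notin> C}"
      using assms(8) by (simp add: matching_def bipartite_complement_def edge_graph_def)
    then show ?thesis using that by blast
  qed
  have disj: "e \<inter> f = {}" if "e \<in> M" "f \<in> M" "e \<noteq> f" for e f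
    using assms(8) that by (auto simp: matching_def)
  \<comment> \<open>This rules out the error case: \<open>\<sigma>\<close> yields a matching with
    \<open>k\<close> edges, and a maximum matching is no smaller.\<close>
  have card_N: "\<not> card N < k" if N: "maximum_matching (colour_relation_complement C ?V1 ?V2 p q k) N" for p q N
  proof -
    from compatible_recolouring_exists[OF fin M disj size, of p q]
    obtain \<sigma> where \<sigma>: "inj_on \<sigma> {1..k}" "\<sigma> ` {1..k} \<subseteq> {1..k}"
      and \<sigma>C: "\<And>x y. x \<in> L \<Longrightarrow> y \<in> R \<Longrightarrow> {x, y} \<in> C \<Longrightarrow> p x \<in> {1..k} \<Longrightarrow> \<sigma> (p x) \<noteq> q y"
      by auto
    have "\<sigma> (p x) \<noteq> q y" if "x \<in> ?V1" "y \<in> ?V2" "{x, y} \<in> C" "p x \<in> {1..k}" for x y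
    proof -
      have "x \<in> L" "y \<in> R" using that by (auto simp: assms(6,7) boundary_parts)
      then show ?thesis using \<sigma>C that by blast
    qed
    then obtain N' where "matching (colour_relation_complement C ?V1 ?V2 p q k) N'" "card N' = k"
      using colour_complement_matching_exists[OF \<sigma>] by metis
    then show ?thesis using N by (auto simp: maximum_matching_def is_arg_max_def)
  qed
  have total: "\<exists>r. reconstruct_scs G C ?V1 ?V2 p q k r" for p q
  proof -
    obtain N where N: "maximum_matching (colour_relation_complement C ?V1 ?V2 p q k) N"
      using maximum_matching_exists[OF finite_colour_complement] by blast
    then have "matching (colour_relation_complement C ?V1 ?V2 p q k) N" "k \<le> card N"
      using card_N[OF N] by (auto simp: maximum_matching_def is_arg_max_def)
    then obtain \<pi> where "\<And>i j. {(i, LeftSide), (j, RightSide)} \<in> N \<Longrightarrow> \<pi> j = i"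
      using perfect_colour_matching(1) by blast
    then show ?thesis using reconstructed[OF comps N card_N[OF N] _ refl] by blast
  qed
  \<comment> \<open>This covers every choice of \<open>N\<close> and \<open>\<pi>\<close> by the
    algorithm. The first two conjuncts give the data separation, and the others are what
    \<open>optimum_recoloured\<close> asks for.\<close>
  have result: "\<exists>p \<pi>. r = Some p \<and> k_partition k (verts G) p \<and> inj_on \<pi> {1..k} \<and>
      (\<forall>v\<in>?V1. p v = p' v) \<and> (\<forall>v\<in>?V2. p v = \<pi> (p'' v)) \<and>
      (\<forall>x\<in>?V1. \<forall>y\<in>?V2. {x, y} \<in> C \<longrightarrow> p x \<noteq> p y)"
    if r: "reconstruct_scs G C ?V1 ?V2 p' p'' k r"
      and part: "k_partition k ?V1 p'" "k_partition k ?V2 p''" for r p' p''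
    using r
  proof cases
    case (not_possible N)
    then show ?thesis using card_N[OF not_possible(3)] by simp
  next
    case (reconstructed N \<pi> p)
    have range: "p' v \<in> {1..k}" if "v \<in> ?V1" for v using part(1) that by (auto simp: k_partition_def)
    have range2: "p'' v \<in> {1..k}" if "v \<in> ?V2" for v using part(2) that by (auto simp: k_partition_def)
    have "matching (colour_relation_complement C ?V1 ?V2 p' p'' k) N" "k \<le> card N"
      using reconstructed by (auto simp: maximum_matching_def is_arg_max_def)
    note * = perfect_colour_matching(2)[where \<pi> = \<pi>, OF this reconstructed(5)]
    have \<pi>: "inj_on \<pi> {1..k}" "\<pi> ` {1..k} \<subseteq> {1..k}"
      "\<And>x y. x \<in> ?V1 \<Longrightarrow> y \<in> ?V2 \<Longrightarrow> {x, y} \<in> C \<Longrightarrow> p' x \<noteq> \<pi> (p'' y)"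
      using * range2 by blast+
    have p1: "p v = p' v" if "v \<in> ?V1" for v
      using that by (simp add: reconstructed(6) verts_Un)
    have p2: "p v = \<pi> (p'' v)" if "v \<in> ?V2" for v
      using that verts_disj by (auto simp: reconstructed(6) verts_Un)
    have "p v \<in> {1..k}" if "v \<in> verts G" for v
    proof (cases "v \<in> ?V1")
      case False
      then have "v \<in> ?V2" using that by (simp add: verts_Un)
      then have "\<pi> (p'' v) \<in> {1..k}" using range2 \<pi>(2) by blast
      then show ?thesis using p2[OF \<open>v \<in> ?V2\<close>] by simp
    qed (simp only: p1 range)
    then have "k_partition k (verts G) p"
      unfolding k_partition_def by (intro PiE_I) (auto simp: reconstructed(6))
    then show ?thesis
      using reconstructed(1) \<pi>(1,3) p1 p2 by (intro exI[of _ p] exI[of _ \<pi>]) simp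
  qed
  have "data_separation k G [G1, G2]
    (\<lambda>ps. reconstruct_scs G C ?V1 ?V2 (ps ! 0) (ps ! 1) k)"
    unfolding data_separation_def
    using simple simple_parts total result
    by (fastforce simp: weighted_graph_def list_all2_Cons1)
  moreover have "optimum_max_k_cut k G p"
    if opt: "optimum_max_k_cut k G1 p'" "optimum_max_k_cut k G2 p''"
      and rec: "reconstruct_scs G C ?V1 ?V2 p' p'' k (Some p)" for p p' p''
  proof -
    have "k_partition k ?V1 p'" "k_partition k ?V2 p''"
      using opt by (auto simp: optimum_max_k_cut_def is_arg_max_def)
    from result[OF rec this] show ?thesis
      using optimum_recoloured[OF opt] by auto
  qed
  ultimately show ?thesis
    unfolding optimality_preserving_data_separation_def by (auto simp: list_all2_Cons1)
qed

end
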